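(* Let $\Gamma=(V,E,o,t)$ be a locally finite graph. Then there is a subset $E'\subset E$ such that $\mathbb{Z}[E]=\operatorname{im}(\partial^* )\oplus\mathbb{Z}[E']$. In particular $\operatorname{im}(\partial^* )$ is a direct summand of $\mathbb{Z}[E]$.
   Context: Graph: sets $V\ne\emptyset$, $E$ and maps $o,t\colon E\to V$ (loops, multiple edges allowed), locally finite (all fibres of $o$ and $t$ finite) and countable. $\partial^*\colon\mathbb{Z}[V]\to\mathbb{Z}[E]$ is the homomorphism $v\mapsto\sum_{t(e)=v}e-\sum_{o(e)=v}e$. *)

theory Defs
  imports
    "HOL-Algebra.Free_Abelian_Groups"
    "HOL-Library.Countable_Set"
    "Graph_Theory.Digraph"
begin

text \<open>
  A graph \<open>(V, E, o, t)\<close> is the record with components \<open>verts\<close>, \<open>arcs\<close>, \<open>tail\<close>, \<open>head\<close>;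
  loops and multiple edges are allowed. The fibres of \<open>t\<close> and \<open>o\<close> over \<open>v\<close> are
  \<open>in_arcs \<Gamma> v\<close> and \<open>out_arcs \<Gamma> v\<close>.
\<close>

locale locally_finite_graph = wf_digraph \<Gamma> for \<Gamma> :: "('v, 'e) pre_digraph" (structure) +
  assumes verts_nonempty: "verts \<Gamma> \<noteq> {}"
    and countable_verts: "countable (verts \<Gamma>)"
    and countable_arcs: "countable (arcs \<Gamma>)"
    and finite_in_arcs: "v \<in> verts \<Gamma> \<Longrightarrow> finite (in_arcs \<Gamma> v)"
    and finite_out_arcs: "v \<in> verts \<Gamma> \<Longrightarrow> finite (out_arcs \<Gamma> v)"

text \<open>
  The map \<open>\<partial>*\<close> is the additive extension of its values on the basis; it represents the
  homomorphism from \<open>\<int>[V]\<close> to \<open>\<int>[E]\<close> when restricted to \<open>carrier (free_Abelian_group (verts \<Gamma>))\<close>.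
\<close>

definition coboundary :: "('v, 'e) pre_digraph \<Rightarrow> ('v \<Rightarrow>\<^sub>0 int) \<Rightarrow> ('e \<Rightarrow>\<^sub>0 int)" where
  "coboundary \<Gamma> =
     frag_extend (\<lambda>v. (\<Sum>e\<in>in_arcs \<Gamma> v. frag_of e) - (\<Sum>e\<in>out_arcs \<Gamma> v. frag_of e))"

definition coboundary_image :: "('v, 'e) pre_digraph \<Rightarrow> ('e \<Rightarrow>\<^sub>0 int) set" where
  "coboundary_image \<Gamma> = coboundary \<Gamma> ` carrier (free_Abelian_group (verts \<Gamma>))"

definition internal_direct_sum :: "('a, 'm) monoid_scheme \<Rightarrow> 'a set \<Rightarrow> 'a set \<Rightarrow> bool" where
  "internal_direct_sum G A B \<longleftrightarrow>
     comm_group G \<and> subgroup A G \<and> subgroup B G \<and>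
     A \<inter> B = {\<one>\<^bsub>G\<^esub>} \<and> A <#>\<^bsub>G\<^esub> B = carrier G"

definition direct_summand :: "'a set \<Rightarrow> ('a, 'm) monoid_scheme \<Rightarrow> bool" where
  "direct_summand A G \<longleftrightarrow> (\<exists>B. internal_direct_sum G A B)"

lemma coboundary_frag_of:
  "coboundary \<Gamma> (frag_of v) =
     (\<Sum>e\<in>in_arcs \<Gamma> v. frag_of e) - (\<Sum>e\<in>out_arcs \<Gamma> v. frag_of e)"
  by (simp add: coboundary_def)

lemma coboundary_in_hom:
  "coboundary \<Gamma> \<in> hom (free_Abelian_group (verts \<Gamma>)) (free_Abelian_group (arcs \<Gamma>))"
proof -
  have sum_keys: "Poly_Mapping.keys (\<Sum>e\<in>A. frag_of e) \<subseteq> A" for A :: "'b set"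
    by (rule order_trans[OF keys_sum]) auto
  have "Poly_Mapping.keys ((\<Sum>e\<in>in_arcs \<Gamma> v. frag_of e) - (\<Sum>e\<in>out_arcs \<Gamma> v. frag_of e))
        \<subseteq> arcs \<Gamma>" for v
    using keys_diff[of "\<Sum>e\<in>in_arcs \<Gamma> v. frag_of e" "\<Sum>e\<in>out_arcs \<Gamma> v. frag_of e"]
      sum_keys[of "in_arcs \<Gamma> v"] sum_keys[of "out_arcs \<Gamma> v"]
    unfolding in_arcs_def out_arcs_def by blast
  then have "Poly_Mapping.keys (coboundary \<Gamma> x) \<subseteq> arcs \<Gamma>" for x
    unfolding coboundary_def by (intro order_trans[OF keys_frag_extend] UN_least)
  then show ?thesis
    by (auto simp: hom_def free_Abelian_group_def) (simp add: coboundary_def frag_extend_add)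
qed

end

theory Submission
  imports Defs
begin

text \<open>
  Choose \<open>E'\<close> maximal among the sets of arcs with \<open>im \<partial>* \<inter> \<int>[E'] = 0\<close>. If \<open>e\<close> is an arc outside
  \<open>E'\<close>, maximality gives a finitely supported potential \<open>f\<close> on the vertices whose coboundary is
  supported in \<open>E' \<union> {e}\<close> and does not vanish at \<open>e\<close>. So \<open>f\<close> takes some nonzero value \<open>c\<close> at exactly
  one endpoint of \<open>e\<close>. The indicator function of the level set \<open>{f = c}\<close> is finitely supported, its
  coboundary vanishes wherever that of \<open>f\<close> does, and its value at \<open>e\<close> is \<open>\<plusminus>1\<close>. Hence
  \<open>e \<in> im \<partial>* + \<int>[E']\<close>.
\<close>

lemma lookup_sum_frag_of:
  "finite A \<Longrightarrow> Poly_Mapping.lookup (\<Sum>a\<in>A. frag_of a) b = of_bool (b \<in> A)"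
  by (induction A rule: finite_induct) (auto simp: lookup_add lookup_single)

lemma coboundary_diff: "coboundary \<Gamma> (x - y) = coboundary \<Gamma> x - coboundary \<Gamma> y"
  by (simp add: coboundary_def frag_extend_diff)

text \<open>Both sides are additive in \<open>x\<close>, so single vertices suffice; at a loop the
  incoming and outgoing terms cancel. From here on, elements of
  \<open>coboundary_image \<Gamma>\<close> can be handled as potential differences along
  arcs.\<close>

lemma (in locally_finite_graph) lookup_coboundary:
  assumes "Poly_Mapping.keys x \<subseteq> verts \<Gamma>" and e: "e \<in> arcs \<Gamma>"
  shows "Poly_Mapping.lookup (coboundary \<Gamma> x) e =
    Poly_Mapping.lookup x (head \<Gamma> e) - Poly_Mapping.lookup x (tail \<Gamma> e)"
  using assms(1)
proof (induction x rule: frag_induction)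
  case zero
  show ?case by (simp add: coboundary_def)
next
  case (one v)
  \<comment> \<open>Local finiteness enters here: a sum over an infinite fibre would be 0 by
    convention.\<close>
  have "finite (in_arcs \<Gamma> v)" "finite (out_arcs \<Gamma> v)"
    using one by (simp_all add: finite_in_arcs finite_out_arcs)
  then show ?case
    using e by (auto simp: coboundary_frag_of lookup_minus lookup_sum_frag_of
        lookup_single when_def in_arcs_def out_arcs_def)
next
  case (diff x y)
  then show ?case by (simp add: coboundary_diff lookup_minus)
qed

lemma subgroup_coboundary_image:
  "subgroup (coboundary_image \<Gamma>) (free_Abelian_group (arcs \<Gamma>))"
proof -
  interpret group_hom "free_Abelian_group (verts \<Gamma>)" "free_Abelian_group (arcs \<Gamma>)" "coboundary \<Gamma>"
    by (simp add: group_hom_def group_hom_axioms_def coboundary_in_hom)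
  show ?thesis
    unfolding coboundary_image_def by (rule img_is_subgroup)
qed

lemma keys_coboundary_image:
  "y \<in> coboundary_image \<Gamma> \<Longrightarrow> Poly_Mapping.keys y \<subseteq> arcs \<Gamma>"
  using subgroup.subset[OF subgroup_coboundary_image]
  by (metis carrier_free_Abelian_group_iff subsetD)

lemma coboundary_image_diff:
  assumes "x \<in> coboundary_image \<Gamma>" "y \<in> coboundary_image \<Gamma>"
  shows "x - y \<in> coboundary_image \<Gamma>"
proof -
  obtain a b where ab: "x = coboundary \<Gamma> a" "y = coboundary \<Gamma> b"
    "Poly_Mapping.keys a \<subseteq> verts \<Gamma>" "Poly_Mapping.keys b \<subseteq> verts \<Gamma>"
    using assms by (auto simp: coboundary_image_def)
  then have "Poly_Mapping.keys (a - b) \<subseteq> verts \<Gamma>"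
    using keys_diff[of a b] by blast
  then show ?thesis
    unfolding ab coboundary_diff[symmetric] by (simp add: coboundary_image_def)
qed

lemma coboundary_image_zero: "0 \<in> coboundary_image \<Gamma>"
  using subgroup.one_closed[OF subgroup_coboundary_image] by simp

lemma coboundary_image_uminus: "x \<in> coboundary_image \<Gamma> \<Longrightarrow> - x \<in> coboundary_image \<Gamma>"
  using coboundary_image_diff[OF coboundary_image_zero, of x] by simp

text \<open>Maximality alone yields only a nonzero coefficient at \<open>e\<close>, by which one
  cannot divide over the integers. Passing to a level set of the potential makes it a unit without
  enlarging the support.\<close>

lemma (in locally_finite_graph) coboundary_image_unit_coefficient:
  assumes "y \<in> coboundary_image \<Gamma>" and e: "e \<in> Poly_Mapping.keys y"
  obtains z where "z \<in> coboundary_image \<Gamma>" "Poly_Mapping.keys z \<subseteq> Poly_Mapping.keys y"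
    "Poly_Mapping.lookup z e = 1"
proof -
  obtain x where x: "y = coboundary \<Gamma> x" "Poly_Mapping.keys x \<subseteq> verts \<Gamma>"
    using assms(1) by (auto simp: coboundary_image_def)
  define f where "f = Poly_Mapping.lookup x"
  have lookup_y: "Poly_Mapping.lookup y a = f (head \<Gamma> a) - f (tail \<Gamma> a)" if "a \<in> arcs \<Gamma>" for a
    using lookup_coboundary[OF x(2) that] by (simp add: x(1) f_def)
  have e_arc: "e \<in> arcs \<Gamma>"
    using e keys_coboundary_image[OF assms(1)] by blast
  have "f (head \<Gamma> e) \<noteq> f (tail \<Gamma> e)"
    using e lookup_y[OF e_arc] by (simp add: in_keys_iff)
  \<comment> \<open>The two endpoint values differ, so at least one of them is nonzero; take it as
    \<open>c\<close>.\<close>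
  then obtain c where c: "c \<noteq> 0" "(f (head \<Gamma> e) = c) \<noteq> (f (tail \<Gamma> e) = c)"
    by metis
  define T where "T = {v. f v = c}"
  \<comment> \<open>As \<open>c\<close> is not 0, the level set lies in the finite support of
    \<open>x\<close>.\<close>
  have T: "T \<subseteq> Poly_Mapping.keys x"
    using c(1) by (auto simp: T_def f_def in_keys_iff)
  then have fin: "finite T"
    using finite_keys finite_subset by blast
  define w where "w = (\<Sum>v\<in>T. frag_of v)"
  have w: "Poly_Mapping.lookup w v = of_bool (f v = c)" for v
    by (simp add: w_def lookup_sum_frag_of[OF fin]) (simp add: T_def)
  then have "Poly_Mapping.keys w \<subseteq> T"
    by (auto simp: in_keys_iff T_def)
  with T x(2) have keys_w: "Poly_Mapping.keys w \<subseteq> verts \<Gamma>"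
    by blast
  define z where "z = coboundary \<Gamma> w"
  have z_im: "z \<in> coboundary_image \<Gamma>"
    using keys_w by (simp add: z_def coboundary_image_def)
  have lookup_z: "Poly_Mapping.lookup z a = of_bool (f (head \<Gamma> a) = c) - of_bool (f (tail \<Gamma> a) = c)"
    if "a \<in> arcs \<Gamma>" for a
    using lookup_coboundary[OF keys_w that] by (simp add: z_def w)
  \<comment> \<open>Where \<open>y\<close> vanishes, \<open>f\<close> agrees at both ends of the
    arc, so \<open>T\<close> contains both ends or neither.\<close>
  have keys_z: "Poly_Mapping.keys z \<subseteq> Poly_Mapping.keys y"
  proof
    fix a assume a: "a \<in> Poly_Mapping.keys z"
    then have "a \<in> arcs \<Gamma>"
      using keys_coboundary_image[OF z_im] by blast
    then show "a \<in> Poly_Mapping.keys y"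
      using a by (auto simp: in_keys_iff lookup_y lookup_z)
  qed
  \<comment> \<open>The sign depends on whether the head or the tail of \<open>e\<close> lies in
    \<open>T\<close>.\<close>
  have "Poly_Mapping.lookup z e = 1 \<or> Poly_Mapping.lookup (- z) e = 1"
    using c(2) lookup_z[OF e_arc] by auto
  then show thesis
    using that z_im keys_z coboundary_image_uminus[OF z_im] by (metis keys_minus)
qed

theorem theorem3p9p1:
  fixes \<Gamma> :: "('v, 'e) pre_digraph"
  assumes "locally_finite_graph \<Gamma>"
  shows "(\<exists>E'. E' \<subseteq> arcs \<Gamma> \<and>
            internal_direct_sum (free_Abelian_group (arcs \<Gamma>))
              (coboundary_image \<Gamma>) (carrier (free_Abelian_group E')))
         \<and> direct_summand (coboundary_image \<Gamma>) (free_Abelian_group (arcs \<Gamma>))"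
proof -
  interpret locally_finite_graph \<Gamma> by fact
  let ?G = "free_Abelian_group (arcs \<Gamma>)" and ?I = "coboundary_image \<Gamma>"
  define indep where "indep F \<longleftrightarrow> F \<subseteq> arcs \<Gamma> \<and> (\<forall>y\<in>?I. Poly_Mapping.keys y \<subseteq> F \<longrightarrow> y = 0)" for F
  have "indep {}"
    by (simp add: indep_def)
  have "indep (\<Union>\<C>)" if "\<C> \<noteq> {}" and chain: "subset.chain {F. indep F} \<C>" for \<C>
  proof -
    have "y = 0" if y: "y \<in> ?I" "Poly_Mapping.keys y \<subseteq> \<Union>\<C>" for y
    proof -
      \<comment> \<open>The support of \<open>y\<close> is finite, so a single member of the chain
        already contains it.\<close>
      obtain F where "F \<in> \<C>" "Poly_Mapping.keys y \<subseteq> F"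
        using finite_subset_Union_chain[OF finite_keys y(2) \<open>\<C> \<noteq> {}\<close> chain]
        by metis
      then show ?thesis
        using chain y(1) by (auto simp: subset_chain_def indep_def)
    qed
    then show ?thesis
      using chain by (auto simp: indep_def subset_chain_def)
  qed
  then have "\<exists>M\<in>{F. indep F}. \<forall>X\<in>{F. indep F}. M \<subseteq> X \<longrightarrow> X = M"
    using \<open>indep {}\<close> by (intro subset_Zorn_nonempty) auto
  then obtain E' where E': "indep E'" and max: "\<And>F. indep F \<Longrightarrow> E' \<subseteq> F \<Longrightarrow> F = E'"
    by blast
  then have sub: "E' \<subseteq> arcs \<Gamma>"
    by (simp add: indep_def)
  have basis: "\<exists>y\<in>?I. Poly_Mapping.keys (frag_of e - y) \<subseteq> E'" if e: "e \<in> arcs \<Gamma>" for e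
  proof (cases "e \<in> E'")
    case True
    then show ?thesis
      using coboundary_image_zero[of \<Gamma>] by (intro bexI[of _ 0]) simp_all
  next
    case False
    then have "\<not> indep (insert e E')"
      using max by blast
    then obtain y where y: "y \<in> ?I" "Poly_Mapping.keys y \<subseteq> insert e E'" "y \<noteq> 0"
      using sub e by (auto simp: indep_def)
    \<comment> \<open>Otherwise \<open>y\<close> would be supported in \<open>E'\<close> and hence
      be 0.\<close>
    then have "e \<in> Poly_Mapping.keys y"
      using E' by (auto simp: indep_def)
    with y(1) obtain z where z: "z \<in> ?I" "Poly_Mapping.keys z \<subseteq> Poly_Mapping.keys y"
      "Poly_Mapping.lookup z e = 1"
      by (rule coboundary_image_unit_coefficient)
    have "Poly_Mapping.keys (frag_of e - z) \<subseteq> insert e E'"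
      using keys_diff[of "frag_of e" z] z(2) y(2) by auto
    \<comment> \<open>The coefficient 1 of \<open>z\<close> cancels \<open>e\<close> exactly,
      leaving only arcs of \<open>E'\<close>.\<close>
    moreover have "e \<notin> Poly_Mapping.keys (frag_of e - z)"
      using z(3) by (simp add: in_keys_iff lookup_minus)
    ultimately show ?thesis
      using z(1) by blast
  qed
  \<comment> \<open>Elements that decompose are closed under differences, so \<open>basis\<close>
    extends to all of \<int>[E].\<close>
  have decompose: "\<exists>y\<in>?I. Poly_Mapping.keys (x - y) \<subseteq> E'" if "Poly_Mapping.keys x \<subseteq> arcs \<Gamma>" for x
    using that
  proof (induction x rule: frag_induction)
    case zero
    show ?case
      using coboundary_image_zero[of \<Gamma>] by (intro bexI[of _ 0]) simp_all
  next
    case (one e)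
    then show ?case by (rule basis)
  next
    case (diff a b)
    then obtain y z where yz: "y \<in> ?I" "z \<in> ?I" "Poly_Mapping.keys (a - y) \<subseteq> E'"
      "Poly_Mapping.keys (b - z) \<subseteq> E'"
      by blast
    then have "Poly_Mapping.keys ((a - y) - (b - z)) \<subseteq> E'"
      using keys_diff[of "a - y" "b - z"] by blast
    then show ?case
      using coboundary_image_diff[OF yz(1,2)] by (intro bexI[of _ "y - z"]) (simp_all add: algebra_simps)
  qed
  have "internal_direct_sum ?G ?I (carrier (free_Abelian_group E'))"
    unfolding internal_direct_sum_def
  proof (intro conjI)
    show "comm_group ?G"
      by (rule abelian_free_Abelian_group)
    show "subgroup ?I ?G"
      by (rule subgroup_coboundary_image)
    show sub_E': "subgroup (carrier (free_Abelian_group E')) ?G"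
    proof
      show "carrier (free_Abelian_group E') \<subseteq> carrier ?G"
        using sub by auto
      show "x \<otimes>\<^bsub>?G\<^esub> y \<in> carrier (free_Abelian_group E')"
        if "x \<in> carrier (free_Abelian_group E')" "y \<in> carrier (free_Abelian_group E')" for x y
        using that Poly_Mapping.keys_add[of x y] by auto
      show "inv\<^bsub>?G\<^esub> x \<in> carrier (free_Abelian_group E')"
        if "x \<in> carrier (free_Abelian_group E')" for x
      proof -
        have "x \<in> carrier ?G" using that sub by auto
        then show ?thesis using that by simp
      qed
    qed simp
    \<comment> \<open>This is the independence of \<open>E'\<close>; its maximality serves only the
      spanning part below.\<close>
    show "?I \<inter> carrier (free_Abelian_group E') = {\<one>\<^bsub>?G\<^esub>}"
      using E' coboundary_image_zero[of \<Gamma>] by (auto simp: indep_def)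
    show "?I <#>\<^bsub>?G\<^esub> carrier (free_Abelian_group E') = carrier ?G"
    proof
      show "?I <#>\<^bsub>?G\<^esub> carrier (free_Abelian_group E') \<subseteq> carrier ?G"
        using subgroup.subset[OF subgroup_coboundary_image] subgroup.subset[OF sub_E']
        by (intro monoid.set_mult_closed) (simp_all add: group.is_monoid)
      show "carrier ?G \<subseteq> ?I <#>\<^bsub>?G\<^esub> carrier (free_Abelian_group E')"
      proof
        fix x assume "x \<in> carrier ?G"
        then obtain y where "y \<in> ?I" "Poly_Mapping.keys (x - y) \<subseteq> E'"
          using decompose[of x] by auto
        then show "x \<in> ?I <#>\<^bsub>?G\<^esub> carrier (free_Abelian_group E')"
          unfolding set_mult_def by (intro UN_I[of y] UN_I[of "x - y"]) simp_all
      qed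
    qed
  qed
  with sub show ?thesis
    unfolding direct_summand_def by blast
qed

end
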